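(* For each integer $n\ge 1$, let $S^{\mathrm{op}}_n$ be the final score of player $\mathsf N$ in semi-restricted Rock, Paper, Scissors played over $3n$ rounds, when both players use optimal strategies (for the expected score). Then, as $n\to\infty$, $$\mathbb E\, S^{\mathrm{op}}_n \sim \sqrt{\frac{27 n}{4\pi}} = \frac{3\sqrt3}{2\sqrt\pi}\,\sqrt n .$$
   Context: Semi-restricted Rock, Paper, Scissors over $3n$ rounds: there are two players, $\mathsf R$ (restricted) and $\mathsf N$ (normal), and three moves rock, paper, scissors, numbered $1,2,3$, where move $i+1$ beats move $i$ (indices mod 3). In each of $3n$ rounds both players simultaneously choose a move, knowing all moves made in earlier rounds; choices may be randomized (and, given the history, the two players' choices in a round are independent). $\mathsf R$ must choose each of the three moves exactly $n$ times during the $3n$ rounds; $\mathsf N$ is unrestricted. A round in which both select the same move is a draw. The final score $S_n$ (of $\mathsf N$) is the number of rounds won by $\mathsf N$ minus the number of rounds won by $\mathsf R$. The objective of $\mathsf N$ is to maximize $\mathbb E S_n$ and that of $\mathsf R$ is to minimize it. This is a finite two-player zero-sum game, so by von Neumann's minimax theorem each player has an optimal randomized strategy; $S^{\mathrm{op}}_n$ denotes the final score when both players use optimal strategies, so that $\mathbb E S^{\mathrm{op}}_n$ is the value of the game. $a_n\sim b_n$ means $a_n/b_n\to1$. *)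

theory Defs
  imports "HOL-Probability.Probability" "HOL-Library.Landau_Symbols"
begin

datatype move = Rock | Paper | Scissors

fun beats :: "move \<Rightarrow> move \<Rightarrow> bool" where
  "beats Paper Rock = True"
| "beats Scissors Paper = True"
| "beats Rock Scissors = True"
| "beats _ _ = False"

text \<open>A history lists the rounds played so far in chronological order; each round is the pair
  (move of R, move of N). A (randomized) strategy gives the distribution of a player's next move
  as a function of the history.\<close>

type_synonym history = "(move \<times> move) list"
type_synonym strategy = "history \<Rightarrow> move pmf"

text \<open>The distribution of the history after a given number of rounds. Given the history, the two
  choices in the next round are independent.\<close>

primrec play :: "strategy \<Rightarrow> strategy \<Rightarrow> nat \<Rightarrow> history pmf" where
  "play \<rho> \<nu> 0 = return_pmf []"
| "play \<rho> \<nu> (Suc k) =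
     bind_pmf (play \<rho> \<nu> k) (\<lambda>h. map_pmf (\<lambda>p. h @ [p]) (pair_pmf (\<rho> h) (\<nu> h)))"

definition score :: "history \<Rightarrow> int" where
  "score h = int (length (filter (\<lambda>(r, s). beats s r) h))
           - int (length (filter (\<lambda>(r, s). beats r s) h))"

definition final_score :: "nat \<Rightarrow> strategy \<Rightarrow> strategy \<Rightarrow> int pmf" where
  "final_score n \<rho> \<nu> = map_pmf score (play \<rho> \<nu> (3 * n))"

definition expected_score :: "nat \<Rightarrow> strategy \<Rightarrow> strategy \<Rightarrow> real" where
  "expected_score n \<rho> \<nu> = measure_pmf.expectation (final_score n \<rho> \<nu>) real_of_int"

text \<open>The restriction on R: whatever N does, R chooses each move exactly \<open>n\<close> times.\<close>

definition admissible :: "nat \<Rightarrow> strategy \<Rightarrow> bool" where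
  "admissible n \<rho> \<longleftrightarrow>
     (\<forall>\<nu>. \<forall>h \<in> set_pmf (play \<rho> \<nu> (3 * n)). \<forall>m. count_list (map fst h) m = n)"

text \<open>Optimality in the sense of von Neumann: a strategy is optimal if the expected score it
  guarantees against every opponent is best possible. All expected scores lie between
  \<open>- 3 * n\<close> and \<open>3 * n\<close>, and admissible strategies exist, so the real-valued infima and suprema
  below are over nonempty bounded sets.\<close>

definition optimal_R :: "nat \<Rightarrow> strategy \<Rightarrow> bool" where
  "optimal_R n \<rho> \<longleftrightarrow> admissible n \<rho> \<and>
     (\<forall>\<rho>'. admissible n \<rho>' \<longrightarrow>
        (SUP \<nu>. expected_score n \<rho> \<nu>) \<le> (SUP \<nu>. expected_score n \<rho>' \<nu>))"

definition optimal_N :: "nat \<Rightarrow> strategy \<Rightarrow> bool" where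
  "optimal_N n \<nu> \<longleftrightarrow>
     (\<forall>\<nu>'. (INF \<rho>\<in>Collect (admissible n). expected_score n \<rho> \<nu>')
         \<le> (INF \<rho>\<in>Collect (admissible n). expected_score n \<rho> \<nu>))"

end

theory Submission
  imports Defs
begin

text \<open>
  Let \<open>R\<close> hold \<open>a\<close> rocks, \<open>b\<close> papers and \<open>c\<close> scissors. Suppose \<open>R\<close> plays uniformly while all three
  moves are available, and with probabilities 1/3 and 2/3 once two are left, the larger one for
  the move that beats the other. Uniform rounds are worth 0 and rounds of the second kind at
  most 1/3 to \<open>N\<close>, and when a single move is left \<open>N\<close> can win each round. The resulting expected score \<open>val a b c\<close> is an
  upper bound for the value of the game. It is the value: \<open>N\<close> can mix so that every move of \<open>R\<close>
  preserves the sum of score and \<open>val\<close> in the mean, because the required probabilities are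
  nonnegative. The reason for the latter is that \<open>val\<close> grows by at most 1 when one card of \<open>R\<close>
  is exchanged for one that it beats (\<open>val_exchange\<close>). Hence the score of any two optimal strategies
  has mean \<open>val n n n\<close> (\<open>game_solution\<close>).

  For the asymptotics, follow the stock of \<open>R\<close> under uniform play until one move is used up. About
  \<open>sqrt n\<close> rounds remain, and in them the score is by the law of large numbers close to
  \<open>gap = max (a - c) (max (b - a) (c - b))\<close>, up to the square root of their number.
  If the uniform walk is continued instead through negative stocks until time \<open>3 * n\<close>, the mean of
  \<open>gap\<close> moves by no more than that order either. So \<open>val n n n\<close> differs from the mean of
  \<open>gap\<close> at time \<open>3 * n\<close> by only \<open>O(n powr (1/4))\<close>. The proof of this (\<open>val_near_walk_avg\<close>) needs no
  stopping times: both quantities are harmonic in the interior, and an explicit harmonic function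
  \<open>err\<close> dominates their difference on the boundary.

  Finally, the mean of \<open>gap\<close> can be computed exactly. By the symmetry of the walk the mean maximum
  of the three differences is half their mean range, which is a sum of absolute values of
  centred binomial variables. De Moivre's formula gives \<open>3 * n * b\<close> with
  \<open>b = (3 * n choose n) * (1/3) ^ n * (2/3) ^ (2 * n)\<close> (\<open>walk_avg_gap_diagonal\<close>), and the
  \<open>Gamma\<close> function gives \<open>sqrt n * b \<longlonglongrightarrow> sqrt 3 / (2 * sqrt pi)\<close> (\<open>binom_third_asymp\<close>).
\<close>

section \<open>The value of a state and the mixtures of both players\<close>

text \<open>The expected score that remains when \<open>R\<close> holds \<open>x\<close> copies of one move, \<open>y\<close> copies of the move
  that beats it, and none of the third. If \<open>R\<close> plays the beaten move with probability \<open>p\<close>, the two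
  sensible replies of \<open>N\<close> earn \<open>p\<close> and \<open>1 - 2 * p\<close> in this round; \<open>p = 1/3\<close> makes them equal, and
  the recursion records this choice. With a single move left, \<open>N\<close> can win every round.\<close>
fun two_val :: "nat \<Rightarrow> nat \<Rightarrow> real" where
  "two_val 0 y = real y"
| "two_val (Suc x) 0 = real (Suc x)"
| "two_val (Suc x) (Suc y) = 1/3 + two_val x (Suc y) / 3 + 2/3 * two_val (Suc x) y"

text \<open>The expected score that remains when \<open>R\<close> holds \<open>a\<close> rocks, \<open>b\<close> papers and \<open>c\<close> scissors and plays
  uniformly as long as all three moves are available: such a round is worth \<open>0\<close> whatever \<open>N\<close> does.
  On the boundary the arguments of \<^const>\<open>two_val\<close> are ordered so that the second move beats the
  first.\<close>
fun val :: "nat \<Rightarrow> nat \<Rightarrow> nat \<Rightarrow> real" where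
  "val (Suc a) (Suc b) (Suc c) =
     (val a (Suc b) (Suc c) + val (Suc a) b (Suc c) + val (Suc a) (Suc b) c) / 3"
| "val a b 0 = two_val a b"
| "val 0 b (Suc c) = two_val b (Suc c)"
| "val (Suc a) 0 (Suc c) = two_val (Suc c) (Suc a)"

lemma two_val_0_right [simp]: "two_val x 0 = real x"
  by (cases x) auto

lemma val_0_left [simp]: "val 0 b c = two_val b c"
  by (cases c) auto

lemma val_0_mid [simp]: "val a 0 c = two_val c a"
  by (cases c; cases a) auto

text \<open>The rules are invariant under the cyclic shift rock, paper, scissors. This symmetry reduces the
  case analyses below to one representative of each kind of state.\<close>
lemma val_rotate: "val a b c = val b c a"
proof (induction "a + b + c" arbitrary: a b c rule: less_induct)
  case less
  show ?case
  proof (cases "a = 0 \<or> b = 0 \<or> c = 0")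
    case True
    then show ?thesis by auto
  next
    case False
    then obtain a' b' c' where [simp]: "a = Suc a'" "b = Suc b'" "c = Suc c'"
      by (metis not0_implies_Suc)
    have "val a' b c = val b c a'" "val a b' c = val b' c a" "val a b c' = val b c' a"
      by (rule less; simp)+
    then show ?thesis by simp
  qed
qed

lemma two_val_1_right: "two_val x 1 = real x + (1/3) ^ x"
  by (induction x) (auto simp: field_simps)

lemma two_val_1_left: "two_val 1 y = real y - 1 + 2 * (2/3) ^ y"
  by (induction y) (auto simp: field_simps)

text \<open>This bounded difference is what makes \<^const>\<open>val\<close> the true value: if trading a card for
  the one that beats it could lower the score still to come by more than one round is worth, \<open>R\<close>
  would deviate from the mixture in the recursion. The induction uses the shifted forms of the
  claim, and in one comparison of a boundary state with an interior one also the composition of two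
  of them, which has the weaker constant 2. If besides the exchanged card only one kind is left,
  the closed forms of
  \<^const>\<open>two_val\<close> at distance one from the axes decide.\<close>
lemma val_exchange: "val (Suc a) b c \<le> val a (Suc b) c + 1"
proof (induction "a + b + c" arbitrary: a b c rule: less_induct)
  case less
  \<comment> \<open>Exchanging along the long way round the cycle takes two exchanges.\<close>
  have 2: "val (Suc x) y z \<le> val x y (Suc z) + 2" if "x + y + z < a + b + c" for x y z
  proof -
    have "val (Suc x) y z \<le> val x (Suc y) z + 1" by (rule less) fact
    moreover have "val (Suc y) z x \<le> val y (Suc z) x + 1" by (rule less) (use that in simp)
    ultimately show ?thesis by (simp add: val_rotate[of x])
  qed
  have rot: "val x (Suc y) z \<le> val x y (Suc z) + 1" "val x y (Suc z) \<le> val (Suc x) y z + 1"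
    if "x + y + z < a + b + c" for x y z
    using less[of y z x] less[of z x y] that
    by (simp_all add: add_ac val_rotate[of x] val_rotate[of "Suc x"] val_rotate[of "Suc z"] val_rotate[of z])
  show ?case
  proof (cases c)
    case [simp]: 0
    show ?thesis
    proof (cases a)
      case [simp]: 0
      have "(2/3::real) ^ b \<le> 1" by (rule power_le_one) auto
      then show ?thesis using two_val_1_left[of b] by simp
    next
      case a: (Suc a')
      show ?thesis
      proof (cases b)
        case [simp]: 0
        show ?thesis using two_val_1_right[of a] by simp
      next
        case b: (Suc b')
        have "val (Suc a') b c \<le> val a' (Suc b) c + 1" "val (Suc a) b' c \<le> val a (Suc b') c + 1"
          by (rule less; simp add: a b)+
        then show ?thesis by (simp add: a b field_simps)
      qed
    qed
  next
    case c: (Suc c')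
    show ?thesis
    proof (cases a)
      case a: 0
      show ?thesis
      proof (cases b)
        case b: 0
        \<comment> \<open>Only scissors besides the exchanged card: compare the two closed forms.\<close>
        have "(1/3::real) ^ c \<le> 2 * (2/3) ^ c"
        proof -
          have "(1/3::real) ^ c \<le> (2/3) ^ c" by (rule power_mono) auto
          also have "\<dots> \<le> 2 * (2/3) ^ c" by simp
          finally show ?thesis .
        qed
        then show ?thesis using two_val_1_left[of c] two_val_1_right[of c]
          by (simp add: a b)
      next
        case b: (Suc b')
        have "val 1 b' c \<le> val 0 (Suc b') c + 1" "val 1 b c' \<le> val 0 (Suc b) c' + 1"
          using less[of 0 b' c] less[of 0 b c'] by (simp_all add: a b c)
        moreover have "val 0 b c \<le> val 0 (Suc b) c' + 2"
          using less[of c' 0 b] less[of 0 b c'] 2[of b c' 0] rot[of 0 b c']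
          by (simp add: a b c add_divide_distrib)
        ultimately show ?thesis by (simp add: a b c add_divide_distrib)
      qed
    next
      case a: (Suc a')
      show ?thesis
      proof (cases b)
        case b: 0
        have "val a b c \<le> val a' (Suc b) c + 1" "val (Suc a) b c' \<le> val a (Suc b) c' + 1"
          using less[of a' 0 c] less[of a 0 c'] by (simp_all add: a b c)
        then show ?thesis by (simp add: a b c add_divide_distrib)
      next
        case b: (Suc b')
        have "val (Suc a') b c \<le> val a' (Suc b) c + 1" "val (Suc a) b' c \<le> val a (Suc b') c + 1"
          "val (Suc a) b c' \<le> val a (Suc b) c' + 1"
          by (rule less; simp add: a b c)+
        then show ?thesis by (simp add: a b c add_divide_distrib)
      qed
    qed
  qed
qed

text \<open>The probabilities \<open>x\<close>, \<open>y\<close>, \<open>z\<close> with which \<open>N\<close> plays rock, paper and scissors secure \<^const>\<open>val\<close>: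
  whatever available move \<open>R\<close> makes, the mean gain of the round and the value of the next state
  together do not fall below the present value.\<close>
definition N_mix_ok :: "nat \<Rightarrow> nat \<Rightarrow> nat \<Rightarrow> real \<Rightarrow> real \<Rightarrow> real \<Rightarrow> bool" where
  "N_mix_ok a b c x y z \<longleftrightarrow> x \<ge> 0 \<and> y \<ge> 0 \<and> z \<ge> 0 \<and> x + y + z = 1 \<and>
     (a > 0 \<longrightarrow> val a b c \<le> y - z + val (a - 1) b c) \<and>
     (b > 0 \<longrightarrow> val a b c \<le> z - x + val a (b - 1) c) \<and>
     (c > 0 \<longrightarrow> val a b c \<le> x - y + val a b (c - 1))"

lemma N_mix_ok_rotate: "N_mix_ok a b c x y z \<Longrightarrow> N_mix_ok b c a y z x"
  unfolding N_mix_ok_def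
  by (auto simp: val_rotate[of a] val_rotate[of "a - Suc 0"])

text \<open>\<open>N\<close> mixes the two moves that can win. The probability of the riskier one is fixed by requiring
  that both moves of \<open>R\<close> lead to exactly the present value, and \<open>val_exchange\<close> says that the
  solution lies between 0 and 1.\<close>
lemma N_mix_ok_two: "\<exists>x y z. N_mix_ok a b 0 x y z"
proof (cases "a = 0 \<or> b = 0")
  case True
  then show ?thesis
  proof
    assume "a = 0"
    then have "N_mix_ok a b 0 0 0 1" by (auto simp: N_mix_ok_def)
    then show ?thesis by blast
  next
    assume "b = 0"
    then have "N_mix_ok a b 0 0 1 0" by (auto simp: N_mix_ok_def)
    then show ?thesis by blast
  qed
next
  case False
  then obtain a' b' where ab: "a = Suc a'" "b = Suc b'" by (metis not0_implies_Suc)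
  define z where "z = 1/3 + (val a' b 0 - val a b' 0) / 3"
  have "val a b' 0 \<le> val a' b 0 + 1"
    using val_exchange[of a' b' 0] by (simp add: ab)
  moreover have "val a' b 0 \<le> val a b' 0 + 2"
    using val_exchange[of b' 0 a'] val_exchange[of 0 a' b']
    by (simp add: ab val_rotate[of "Suc 0"] val_rotate[of _ "Suc 0"])
  ultimately have "N_mix_ok a b 0 0 (1 - z) z"
    by (auto simp: N_mix_ok_def ab z_def field_simps)
  then show ?thesis by blast
qed

text \<open>In an interior state the three equations that make \<open>R\<close> indifferent determine the mixture; each
  probability is a third of \<open>1\<close> plus a difference of neighbouring values, hence nonnegative by
  \<open>val_exchange\<close>.\<close>
lemma N_mix_ok_ex: "\<exists>x y z. N_mix_ok a b c x y z"
proof (cases "a = 0 \<or> b = 0 \<or> c = 0")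
  case True
  then show ?thesis using N_mix_ok_two N_mix_ok_rotate by metis
next
  case False
  then obtain a' b' c' where abc: "a = Suc a'" "b = Suc b'" "c = Suc c'"
    by (metis not0_implies_Suc)
  define u v w where u_v_w_def: "u = val a' b c" "v = val a b' c" "w = val a b c'"
  have "v \<le> u + 1"
    using val_exchange[of a' b' c] by (simp add: abc u_v_w_def)
  moreover have "w \<le> v + 1"
    using val_exchange[of b' c' a] val_rotate[of a b c'] val_rotate[of a b' c]
    by (simp only: abc u_v_w_def)
  moreover have "u \<le> w + 1"
    using val_exchange[of c' a' b] val_rotate[of c a' b] val_rotate[of c' a b]
    by (simp only: abc u_v_w_def)
  ultimately have "N_mix_ok a b c (1/3 + (v - w)/3) (1/3 + (w - u)/3) (1/3 + (u - v)/3)"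
    by (auto simp: N_mix_ok_def abc u_v_w_def field_simps)
  then show ?thesis by blast
qed

text \<open>The same for \<open>R\<close>: the maximum is the mean gain of the best reply of \<open>N\<close> to the mixture
  \<open>x\<close>, \<open>y\<close>, \<open>z\<close>. Moves that are used up have probability 0, so that \<open>R\<close> keeps to the restriction.\<close>
definition R_mix_ok :: "nat \<Rightarrow> nat \<Rightarrow> nat \<Rightarrow> real \<Rightarrow> real \<Rightarrow> real \<Rightarrow> bool" where
  "R_mix_ok a b c x y z \<longleftrightarrow> x \<ge> 0 \<and> y \<ge> 0 \<and> z \<ge> 0 \<and> x + y + z = 1 \<and>
     (a = 0 \<longrightarrow> x = 0) \<and> (b = 0 \<longrightarrow> y = 0) \<and> (c = 0 \<longrightarrow> z = 0) \<and>
     max (x - z) (max (y - x) (z - y)) + x * val (a - 1) b c + y * val a (b - 1) c + z * val a b (c - 1)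
       \<le> val a b c"

lemma R_mix_ok_rotate: "R_mix_ok a b c x y z \<Longrightarrow> R_mix_ok b c a y z x"
  unfolding R_mix_ok_def
  by (auto simp: val_rotate[of a] val_rotate[of "a - Suc 0"] max.commute max.left_commute)

lemma R_mix_ok_two: "a + b > 0 \<Longrightarrow> \<exists>x y z. R_mix_ok a b 0 x y z"
proof -
  assume "a + b > 0"
  then consider "a = 0" "b > 0" | "b = 0" "a > 0" | a' b' where "a = Suc a'" "b = Suc b'"
    by (metis not0_implies_Suc gr0I add_is_0)
  then show ?thesis
  proof cases
    case 1
    then have "R_mix_ok a b 0 0 1 0" by (auto simp: R_mix_ok_def)
    then show ?thesis by blast
  next
    case 2
    then have "R_mix_ok a b 0 1 0 0" by (auto simp: R_mix_ok_def)
    then show ?thesis by blast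
  next
    case 3
    then have "R_mix_ok a b 0 (1/3) (2/3) 0" by (auto simp: R_mix_ok_def)
    then show ?thesis by blast
  qed
qed

lemma R_mix_ok_ex: "a + b + c > 0 \<Longrightarrow> \<exists>x y z. R_mix_ok a b c x y z"
proof (cases "a = 0 \<or> b = 0 \<or> c = 0")
  case True
  assume "a + b + c > 0"
  with True show ?thesis
    using R_mix_ok_two R_mix_ok_rotate by (metis add.commute add.left_neutral add.right_neutral)
next
  case False
  then obtain a' b' c' where abc: "a = Suc a'" "b = Suc b'" "c = Suc c'"
    by (metis not0_implies_Suc)
  then have "R_mix_ok a b c (1/3) (1/3) (1/3)" by (auto simp: R_mix_ok_def)
  then show ?thesis by blast
qed

section \<open>From one-round inequalities to the value of the game\<close>

lemma UNIV_move: "(UNIV :: move set) = {Rock, Paper, Scissors}"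
  by (auto intro: move.exhaust)

instance move :: finite
  by standard (simp add: UNIV_move)

lemma sum_move: "(\<Sum>m\<in>UNIV. g m) = g Rock + g Paper + (g Scissors :: real)"
  by (simp add: UNIV_move add_ac)

lemma all_move: "(\<forall>m. P m) \<longleftrightarrow> P Rock \<and> P Paper \<and> P Scissors"
  by (metis move.exhaust)

text \<open>Turns the real weights found above into randomized moves.\<close>
lemma ex_pmf_move:
  assumes "x \<ge> 0" "y \<ge> 0" "z \<ge> (0::real)" "x + y + z = 1"
  shows "\<exists>p. pmf p Rock = x \<and> pmf p Paper = y \<and> pmf p Scissors = z"
proof -
  define f where "f = case_move x y z"
  have nonneg: "f m \<ge> 0" for m using assms by (cases m) (auto simp: f_def)
  have "(\<integral>\<^sup>+m. ennreal (f m) \<partial>count_space UNIV) = (\<Sum>m\<in>UNIV. ennreal (f m))"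
    by (rule nn_integral_count_space_finite) simp
  also have "\<dots> = ennreal (\<Sum>m\<in>UNIV. f m)"
    using nonneg by (simp add: sum_ennreal)
  also have "(\<Sum>m\<in>UNIV. f m) = 1" using assms by (simp add: sum_move f_def)
  finally have "pmf (embed_pmf f) m = f m" for m
    using nonneg by (intro pmf_embed_pmf) auto
  then show ?thesis by (intro exI[of _ "embed_pmf f"]) (simp add: f_def)
qed

text \<open>The arguments are the move of \<open>N\<close> and then that of \<open>R\<close>.\<close>
definition payoff :: "move \<Rightarrow> move \<Rightarrow> real" where
  "payoff s r = of_bool (beats s r) - of_bool (beats r s)"

lemma score_Nil [simp]: "score [] = 0"
  by (simp add: score_def)

lemma score_snoc: "real_of_int (score (h @ [(r, s)])) = score h + payoff s r"
  by (simp add: score_def payoff_def)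

definition remaining :: "nat \<Rightarrow> history \<Rightarrow> move \<Rightarrow> nat" where
  "remaining n h m = n - count_list (map fst h) m"

lemma remaining_Nil [simp]: "remaining n [] = (\<lambda>_. n)"
  by (rule ext) (simp add: remaining_def)

lemma remaining_snoc:
  "remaining n (h @ [(r, s)]) = (remaining n h)(r := remaining n h r - 1)"
  by (auto simp: remaining_def)

lemma sum_count_moves: "(\<Sum>m\<in>UNIV. real (count_list xs m)) = length xs" for xs :: "move list"
proof -
  have "(\<Sum>m\<in>UNIV. count_list xs m) = length xs"
    using sum_count_set[of xs UNIV] by simp
  then show ?thesis by (metis of_nat_sum)
qed

lemma finite_play [simp]: "finite (set_pmf (play \<rho> \<nu> k))"
  by (induction k) auto

lemma length_play: "h \<in> set_pmf (play \<rho> \<nu> k) \<Longrightarrow> length h = k"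
  by (induction k arbitrary: h) auto

lemma play_snoc:
  assumes "h \<in> set_pmf (play \<rho> \<nu> k)" "r \<in> set_pmf (\<rho> h)" "s \<in> set_pmf (\<nu> h)"
  shows "h @ [(r, s)] \<in> set_pmf (play \<rho> \<nu> (Suc k))"
  using assms by auto

text \<open>Admissibility speaks only about complete plays. Since every partial play can be completed, it
  also constrains the moves made on the way.\<close>
lemma play_extend:
  assumes "h \<in> set_pmf (play \<rho> \<nu> k)" "k \<le> m"
  shows "\<exists>h'. h @ h' \<in> set_pmf (play \<rho> \<nu> m)"
  using assms(2)
proof (induction m rule: dec_induct)
  case base
  show ?case using assms(1) by (intro exI[of _ "[]"]) simp
next
  case (step m)
  then obtain h' where h': "h @ h' \<in> set_pmf (play \<rho> \<nu> m)" by blast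
  obtain r s where "r \<in> set_pmf (\<rho> (h @ h'))" "s \<in> set_pmf (\<nu> (h @ h'))"
    using set_pmf_not_empty by (metis ex_in_conv)
  then have "h @ (h' @ [(r, s)]) \<in> set_pmf (play \<rho> \<nu> (Suc m))"
    using play_snoc[OF h'] by simp
  then show ?case by blast
qed

lemma expectation_play_Suc:
  fixes F :: "history \<Rightarrow> real"
  shows "measure_pmf.expectation (play \<rho> \<nu> (Suc k)) F =
    measure_pmf.expectation (play \<rho> \<nu> k)
      (\<lambda>h. \<Sum>r\<in>UNIV. pmf (\<rho> h) r * (\<Sum>s\<in>UNIV. pmf (\<nu> h) s * F (h @ [(r, s)])))"
proof -
  have inner: "measure_pmf.expectation (map_pmf (\<lambda>p. h @ [p]) (pair_pmf (\<rho> h) (\<nu> h))) F =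
      (\<Sum>r\<in>UNIV. pmf (\<rho> h) r * (\<Sum>s\<in>UNIV. pmf (\<nu> h) s * F (h @ [(r, s)])))" for h
  proof -
    have "measure_pmf.expectation (map_pmf (\<lambda>p. h @ [p]) (pair_pmf (\<rho> h) (\<nu> h))) F =
        (\<Sum>p\<in>UNIV. F (h @ [p]) * pmf (pair_pmf (\<rho> h) (\<nu> h)) p)"
      by (simp add: integral_measure_pmf_real[where A = UNIV])
    also have "\<dots> = (\<Sum>(r, s)\<in>UNIV \<times> UNIV. F (h @ [(r, s)]) * (pmf (\<rho> h) r * pmf (\<nu> h) s))"
      by (simp add: pmf_pair case_prod_unfold flip: pmf_pair)
    also have "\<dots> = (\<Sum>r\<in>UNIV. pmf (\<rho> h) r * (\<Sum>s\<in>UNIV. pmf (\<nu> h) s * F (h @ [(r, s)])))"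
      unfolding sum.cartesian_product[symmetric] by (simp add: sum_distrib_left mult_ac)
    finally show ?thesis .
  qed
  show ?thesis
    unfolding play.simps
    by (subst pmf_expectation_bind[where A = "set_pmf (play \<rho> \<nu> k)"])
       (auto simp: inner integral_measure_pmf_real[where A = "set_pmf (play \<rho> \<nu> k)"] mult_ac
             simp del: integral_map_pmf)
qed

lemma expectation_play_mono:
  fixes F G :: "history \<Rightarrow> real"
  assumes "\<And>h. h \<in> set_pmf (play \<rho> \<nu> k) \<Longrightarrow> F h \<le> G h"
  shows "measure_pmf.expectation (play \<rho> \<nu> k) F \<le> measure_pmf.expectation (play \<rho> \<nu> k) G"
  by (rule integral_mono_AE) (auto simp: integrable_measure_pmf_finite AE_measure_pmf_iff assms)

lemma expected_score_eq:
  "expected_score n \<rho> \<nu> = measure_pmf.expectation (play \<rho> \<nu> (3 * n)) (\<lambda>h. real_of_int (score h))"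
  by (simp add: expected_score_def final_score_def)

lemma sum_pmf_move: "(\<Sum>m\<in>UNIV. pmf p (m::move)) = 1"
  by (rule sum_pmf_eq_1) auto

lemma admissible_remaining_pos:
  assumes adm: "admissible n \<rho>" and h: "h \<in> set_pmf (play \<rho> \<nu> k)" and k: "k < 3 * n"
    and r: "r \<in> set_pmf (\<rho> h)"
  shows "remaining n h r > 0"
proof -
  obtain s where "s \<in> set_pmf (\<nu> h)" using set_pmf_not_empty by (metis ex_in_conv)
  then have "h @ [(r, s)] \<in> set_pmf (play \<rho> \<nu> (Suc k))" by (rule play_snoc[OF h r])
  then obtain h' where "(h @ [(r, s)]) @ h' \<in> set_pmf (play \<rho> \<nu> (3 * n))"
    using play_extend[of _ \<rho> \<nu> "Suc k" "3 * n"] k by fastforce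
  then have "count_list (map fst ((h @ [(r, s)]) @ h')) r = n"
    using adm unfolding admissible_def by blast
  then show ?thesis by (simp add: remaining_def)
qed

lemma final_remaining:
  assumes "admissible n \<rho>" "h \<in> set_pmf (play \<rho> \<nu> (3 * n))"
  shows "remaining n h = (\<lambda>_. 0)"
  using assms by (auto simp: admissible_def remaining_def)

definition state_val :: "(move \<Rightarrow> nat) \<Rightarrow> real" where
  "state_val f = val (f Rock) (f Paper) (f Scissors)"

text \<open>The score already made plus the value of the present state. It is a submartingale under the
  mixtures of \<open>N\<close> and a supermartingale under those of \<open>R\<close>, whatever the opponent does, and it
  turns into the final score when all cards have been played.\<close>
definition potential :: "nat \<Rightarrow> history \<Rightarrow> real" where
  "potential n h = score h + state_val (remaining n h)"

definition step_val :: "(move \<Rightarrow> nat) \<Rightarrow> move \<Rightarrow> real" where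
  "step_val f r = state_val (f(r := f r - 1))"

lemma potential_snoc:
  "potential n (h @ [(r, s)]) = score h + payoff s r + step_val (remaining n h) r"
  by (simp add: potential_def score_snoc remaining_snoc step_val_def)

lemma expectation_potential_0:
  "measure_pmf.expectation (play \<rho> \<nu> 0) (potential n) = val n n n"
  by (simp add: potential_def state_val_def)

lemma expectation_potential_end:
  assumes "admissible n \<rho>"
  shows "measure_pmf.expectation (play \<rho> \<nu> (3 * n)) (potential n) = expected_score n \<rho> \<nu>"
  unfolding expected_score_eq
proof (rule integral_cong_AE)
  show "AE h in measure_pmf (play \<rho> \<nu> (3 * n)). potential n h = real_of_int (score h)"
    using final_remaining[OF assms]
    by (auto simp: AE_measure_pmf_iff potential_def state_val_def)
qed auto

lemma N_guarantee:
  assumes "\<And>h r. remaining n h r > 0 \<Longrightarrow>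
     state_val (remaining n h) \<le> (\<Sum>s\<in>UNIV. pmf (\<nu> h) s * payoff s r) + step_val (remaining n h) r"
    and adm: "admissible n \<rho>"
  shows "val n n n \<le> expected_score n \<rho> \<nu>"
proof -
  have "val n n n \<le> measure_pmf.expectation (play \<rho> \<nu> k) (potential n)" if "k \<le> 3 * n" for k
    using that
  proof (induction k)
    case 0
    then show ?case using expectation_potential_0 by simp
  next
    case (Suc k)
    then have "val n n n \<le> measure_pmf.expectation (play \<rho> \<nu> k) (potential n)" by simp
    also have "\<dots> \<le> measure_pmf.expectation (play \<rho> \<nu> (Suc k)) (potential n)"
      unfolding expectation_play_Suc
    proof (rule expectation_play_mono)
      fix h assume h: "h \<in> set_pmf (play \<rho> \<nu> k)"
      have "potential n h = (\<Sum>r\<in>UNIV. pmf (\<rho> h) r * potential n h)"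
        by (simp add: sum_pmf_move flip: sum_distrib_right)
      also have "\<dots> \<le> (\<Sum>r\<in>UNIV. pmf (\<rho> h) r * (\<Sum>s\<in>UNIV. pmf (\<nu> h) s * potential n (h @ [(r, s)])))"
      proof (rule sum_mono)
        fix r :: move
        show "pmf (\<rho> h) r * potential n h
          \<le> pmf (\<rho> h) r * (\<Sum>s\<in>UNIV. pmf (\<nu> h) s * potential n (h @ [(r, s)]))"
        proof (cases "r \<in> set_pmf (\<rho> h)")
          case True
          then have "remaining n h r > 0"
            using admissible_remaining_pos[OF adm h] Suc.prems by simp
          then have "potential n h \<le> score h + (\<Sum>s\<in>UNIV. pmf (\<nu> h) s * payoff s r) + step_val (remaining n h) r"
            using assms(1) by (simp add: potential_def)
          also have "\<dots> = (\<Sum>s\<in>UNIV. pmf (\<nu> h) s * potential n (h @ [(r, s)]))"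
            by (simp add: potential_snoc distrib_left sum.distrib sum_pmf_move flip: sum_distrib_right)
          finally show ?thesis by (rule mult_left_mono) simp
        next
          case False
          then show ?thesis by (simp add: set_pmf_iff)
        qed
      qed
      finally show "potential n h
        \<le> (\<Sum>r\<in>UNIV. pmf (\<rho> h) r * (\<Sum>s\<in>UNIV. pmf (\<nu> h) s * potential n (h @ [(r, s)])))" .
    qed
    finally show ?case .
  qed
  from this[of "3 * n"] show ?thesis using expectation_potential_end[OF adm] by simp
qed

text \<open>Admissibility is part of the conclusion: no move is made more than \<open>n\<close> times, and \<open>3 * n\<close> rounds
  have been played in the end.\<close>
lemma R_guarantee:
  assumes bound: "\<And>h s. \<exists>m. remaining n h m > 0 \<Longrightarrow>
     (\<Sum>r\<in>UNIV. pmf (\<rho> h) r * (payoff s r + step_val (remaining n h) r)) \<le> state_val (remaining n h)"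
    and supp: "\<And>h r. \<exists>m. remaining n h m > 0 \<Longrightarrow> r \<in> set_pmf (\<rho> h) \<Longrightarrow> remaining n h r > 0"
  shows "admissible n \<rho>" and "expected_score n \<rho> \<nu> \<le> val n n n"
proof -
  have pos: "\<exists>m. remaining n h m > 0" if "length h < 3 * n" for h
  proof (rule ccontr)
    assume "\<nexists>m. remaining n h m > 0"
    then have "count_list (map fst h) m \<ge> n" for m by (simp add: remaining_def not_less)
    then have "(\<Sum>m\<in>UNIV. real (count_list (map fst h) m)) \<ge> 3 * real n"
      unfolding sum_move by (smt (verit) of_nat_le_iff)
    then show False using that unfolding sum_count_moves by simp
  qed
  have counts: "count_list (map fst h) m \<le> n"
    if "h \<in> set_pmf (play \<rho> \<nu> k)" "k \<le> 3 * n" for h \<nu> k m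
    using that
  proof (induction k arbitrary: h)
    case 0
    then show ?case by simp
  next
    case (Suc k)
    then obtain h' r s where h': "h' \<in> set_pmf (play \<rho> \<nu> k)" and r: "r \<in> set_pmf (\<rho> h')"
      and h: "h = h' @ [(r, s)]" by auto
    have "remaining n h' r > 0"
      using supp[OF pos r] length_play[OF h'] Suc.prems by simp
    moreover have "count_list (map fst h') m \<le> n" using Suc h' by simp
    ultimately show ?case by (auto simp: h remaining_def)
  qed
  show adm: "admissible n \<rho>"
    unfolding admissible_def
  proof (intro allI ballI)
    fix \<nu> h m
    assume h: "h \<in> set_pmf (play \<rho> \<nu> (3 * n))"
    have "(\<Sum>m\<in>UNIV. real (count_list (map fst h) m)) = 3 * real n"
      unfolding sum_count_moves using length_play[OF h] by simp
    then show "count_list (map fst h) m = n"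
      using counts[OF h, of Rock] counts[OF h, of Paper] counts[OF h, of Scissors]
      unfolding sum_move by (cases m) auto
  qed
  have "measure_pmf.expectation (play \<rho> \<nu> k) (potential n) \<le> val n n n" if "k \<le> 3 * n" for k
    using that
  proof (induction k)
    case 0
    then show ?case using expectation_potential_0 by simp
  next
    case (Suc k)
    have "measure_pmf.expectation (play \<rho> \<nu> (Suc k)) (potential n)
        \<le> measure_pmf.expectation (play \<rho> \<nu> k) (potential n)"
      unfolding expectation_play_Suc
    proof (rule expectation_play_mono)
      fix h assume h: "h \<in> set_pmf (play \<rho> \<nu> k)"
      have ex: "\<exists>m. remaining n h m > 0"
        using pos length_play[OF h] Suc.prems by simp
      have "(\<Sum>r\<in>UNIV. pmf (\<rho> h) r * (\<Sum>s\<in>UNIV. pmf (\<nu> h) s * potential n (h @ [(r, s)])))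
          = (\<Sum>s\<in>UNIV. pmf (\<nu> h) s * (\<Sum>r\<in>UNIV. pmf (\<rho> h) r * potential n (h @ [(r, s)])))"
        unfolding sum_distrib_left by (subst sum.swap) (simp add: mult_ac)
      also have "\<dots> \<le> (\<Sum>s\<in>UNIV. pmf (\<nu> h) s * potential n h)"
      proof (intro sum_mono mult_left_mono)
        fix s :: move
        have "(\<Sum>r\<in>UNIV. pmf (\<rho> h) r * potential n (h @ [(r, s)]))
            = score h + (\<Sum>r\<in>UNIV. pmf (\<rho> h) r * (payoff s r + step_val (remaining n h) r))"
          by (simp add: potential_snoc distrib_left sum.distrib sum_pmf_move flip: sum_distrib_right)
        also have "\<dots> \<le> potential n h" using bound[OF ex] by (simp add: potential_def)
        finally show "(\<Sum>r\<in>UNIV. pmf (\<rho> h) r * potential n (h @ [(r, s)])) \<le> potential n h" .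
      qed simp
      also have "\<dots> = potential n h"
        by (simp add: sum_pmf_move flip: sum_distrib_right)
      finally show "(\<Sum>r\<in>UNIV. pmf (\<rho> h) r * (\<Sum>s\<in>UNIV. pmf (\<nu> h) s * potential n (h @ [(r, s)])))
        \<le> potential n h" .
    qed
    then show ?case using Suc by simp
  qed
  from this[of "3 * n"] show "expected_score n \<rho> \<nu> \<le> val n n n"
    using expectation_potential_end[OF adm] by simp
qed

lemma N_strategy_ex: "\<exists>\<nu>. \<forall>\<rho>. admissible n \<rho> \<longrightarrow> val n n n \<le> expected_score n \<rho> \<nu>"
proof -
  have "\<exists>q. \<forall>r. f r > 0 \<longrightarrow> state_val f \<le> (\<Sum>s\<in>UNIV. pmf q s * payoff s r) + step_val f r" for f
  proof -
    obtain x y z where xyz: "N_mix_ok (f Rock) (f Paper) (f Scissors) x y z"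
      using N_mix_ok_ex by blast
    then obtain q where "pmf q Rock = x" "pmf q Paper = y" "pmf q Scissors = z"
      using ex_pmf_move[of x y z] unfolding N_mix_ok_def by blast
    then show ?thesis using xyz
      by (intro exI[of _ q])
         (auto simp: all_move sum_move payoff_def state_val_def step_val_def N_mix_ok_def)
  qed
  then have "\<exists>q. \<forall>f r. f r > 0 \<longrightarrow>
      state_val f \<le> (\<Sum>s\<in>UNIV. pmf (q f) s * payoff s r) + step_val f r"
    by (intro choice allI)
  then obtain q where q: "\<And>f r. f r > 0 \<Longrightarrow>
      state_val f \<le> (\<Sum>s\<in>UNIV. pmf (q f) s * payoff s r) + step_val f r"
    by blast
  have "val n n n \<le> expected_score n \<rho> (\<lambda>h. q (remaining n h))" if "admissible n \<rho>" for \<rho>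
    by (rule N_guarantee[OF q that])
  then show ?thesis by blast
qed

lemma R_strategy_ex: "\<exists>\<rho>. admissible n \<rho> \<and> (\<forall>\<nu>. expected_score n \<rho> \<nu> \<le> val n n n)"
proof -
  define good where "good f p \<longleftrightarrow> ((\<exists>m. f m > 0) \<longrightarrow>
      (\<forall>s. (\<Sum>r\<in>UNIV. pmf p r * (payoff s r + step_val f r)) \<le> state_val f) \<and>
      (\<forall>r\<in>set_pmf p. f r > 0))" for f p
  have "\<exists>p. good f p" for f
  proof (cases "\<exists>m. f m > 0")
    case True
    then obtain m where "f m > 0" by blast
    then have pos: "f Rock + f Paper + f Scissors > 0" by (cases m) simp_all
    obtain x y z where xyz: "R_mix_ok (f Rock) (f Paper) (f Scissors) x y z"
      using R_mix_ok_ex[OF pos] by blast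
    then obtain p where p: "pmf p Rock = x" "pmf p Paper = y" "pmf p Scissors = z"
      using ex_pmf_move[of x y z] unfolding R_mix_ok_def by blast
    have "f Rock = 0 \<longrightarrow> x = 0" "f Paper = 0 \<longrightarrow> y = 0" "f Scissors = 0 \<longrightarrow> z = 0"
      using xyz unfolding R_mix_ok_def by blast+
    then have "f r > 0" if "r \<in> set_pmf p" for r
      using that p by (cases r) (auto simp: set_pmf_iff)
    moreover have "(\<Sum>r\<in>UNIV. pmf p r * (payoff s r + step_val f r)) \<le> state_val f" for s
    proof -
      have eq: "(\<Sum>r\<in>UNIV. pmf p r * (payoff s r + step_val f r))
          = (case s of Rock \<Rightarrow> z - y | Paper \<Rightarrow> x - z | Scissors \<Rightarrow> y - x)
            + x * step_val f Rock + y * step_val f Paper + z * step_val f Scissors"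
        using p by (cases s) (simp_all add: sum_move payoff_def algebra_simps)
      have "(case s of Rock \<Rightarrow> z - y | Paper \<Rightarrow> x - z | Scissors \<Rightarrow> y - x)
          \<le> max (x - z) (max (y - x) (z - y))"
        by (cases s) auto
      moreover have "max (x - z) (max (y - x) (z - y))
          + x * step_val f Rock + y * step_val f Paper + z * step_val f Scissors \<le> state_val f"
        using xyz by (simp add: R_mix_ok_def state_val_def step_val_def)
      ultimately show ?thesis unfolding eq by linarith
    qed
    ultimately show ?thesis unfolding good_def by blast
  qed (simp add: good_def)
  then have "\<exists>p. \<forall>f. good f (p f)" by (intro choice allI)
  then obtain p where p: "\<And>f. good f (p f)" by blast
  let ?\<rho> = "\<lambda>h. p (remaining n h)"
  have bound: "(\<Sum>r\<in>UNIV. pmf (?\<rho> h) r * (payoff s r + step_val (remaining n h) r))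
      \<le> state_val (remaining n h)" if "\<exists>m. remaining n h m > 0" for h s
    using p[of "remaining n h"] that unfolding good_def by blast
  have supp: "remaining n h r > 0" if "\<exists>m. remaining n h m > 0" "r \<in> set_pmf (?\<rho> h)" for h r
    using p[of "remaining n h"] that unfolding good_def by blast
  have "admissible n ?\<rho>" by (rule R_guarantee(1)) (fact bound, fact supp)
  moreover have "expected_score n ?\<rho> \<nu> \<le> val n n n" for \<nu>
    by (rule R_guarantee(2)) (fact bound, fact supp)
  ultimately show ?thesis by blast
qed

lemma abs_score_le: "\<bar>score h\<bar> \<le> int (length h)"
proof -
  have "length (filter (\<lambda>(r, s). beats s r) h) \<le> length h" "length (filter (\<lambda>(r, s). beats r s) h) \<le> length h"
    by auto
  then show ?thesis unfolding score_def by linarith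
qed

lemma abs_expected_score_le: "\<bar>expected_score n \<rho> \<nu>\<bar> \<le> 3 * real n"
proof -
  have *: "\<bar>real_of_int (score h)\<bar> \<le> 3 * real n" if "h \<in> set_pmf (play \<rho> \<nu> (3 * n))" for h
    using abs_score_le[of h] length_play[OF that] by linarith
  have "expected_score n \<rho> \<nu> \<le> measure_pmf.expectation (play \<rho> \<nu> (3 * n)) (\<lambda>_. 3 * real n)"
    unfolding expected_score_eq by (rule expectation_play_mono) (use * in force)
  moreover have "measure_pmf.expectation (play \<rho> \<nu> (3 * n)) (\<lambda>_. - (3 * real n)) \<le> expected_score n \<rho> \<nu>"
    unfolding expected_score_eq by (rule expectation_play_mono) (use * in force)
  ultimately show ?thesis by simp
qed

lemma bdd_above_expected_score: "bdd_above (range (expected_score n \<rho>))"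
  using abs_expected_score_le by (fastforce simp: bdd_above_def abs_le_iff)

lemma bdd_below_expected_score: "bdd_below ((\<lambda>\<rho>. expected_score n \<rho> \<nu>) ` A)"
proof (rule bdd_belowI2)
  show "- (3 * real n) \<le> expected_score n \<rho> \<nu>" for \<rho>
    using abs_expected_score_le[of n \<rho> \<nu>] by linarith
qed

text \<open>A guarantee of one player bounds what the opponent can secure. Two guarantees that meet in \<open>v\<close>
  therefore cannot be improved, and optimal strategies have to match them.\<close>
lemma saddle:
  assumes \<rho>: "admissible n \<rho>" "\<And>\<nu>'. expected_score n \<rho> \<nu>' \<le> v"
    and \<nu>: "\<And>\<rho>'. admissible n \<rho>' \<Longrightarrow> v \<le> expected_score n \<rho>' \<nu>"
  shows "optimal_R n \<rho>" "optimal_N n \<nu>"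
    and "\<And>\<rho>' \<nu>'. optimal_R n \<rho>' \<Longrightarrow> optimal_N n \<nu>' \<Longrightarrow> expected_score n \<rho>' \<nu>' = v"
proof -
  have sup: "(SUP \<nu>'. expected_score n \<rho> \<nu>') \<le> v" by (rule cSUP_least) (use \<rho> in auto)
  have inf: "v \<le> (INF \<rho>'\<in>Collect (admissible n). expected_score n \<rho>' \<nu>)"
    by (rule cINF_greatest) (use \<rho> \<nu> in auto)
  have "v \<le> (SUP \<nu>'. expected_score n \<rho>' \<nu>')" if "admissible n \<rho>'" for \<rho>'
    using \<nu>[OF that] cSUP_upper[OF UNIV_I bdd_above_expected_score[of n \<rho>'], of \<nu>] by linarith
  with sup \<rho> show "optimal_R n \<rho>" unfolding optimal_R_def by force
  have "(INF \<rho>'\<in>Collect (admissible n). expected_score n \<rho>' \<nu>') \<le> v" for \<nu>'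
    using \<rho>(2)[of \<nu>'] cINF_lower[OF bdd_below_expected_score[of n \<nu>' "Collect (admissible n)"], of \<rho>] \<rho>(1)
    by simp
  then show "optimal_N n \<nu>" unfolding optimal_N_def using inf order_trans by blast
  fix \<rho>' \<nu>' assume opt: "optimal_R n \<rho>'" "optimal_N n \<nu>'"
  have "(SUP \<nu>'. expected_score n \<rho>' \<nu>') \<le> v"
    using opt(1) sup \<rho>(1) unfolding optimal_R_def by force
  moreover have "expected_score n \<rho>' \<nu>' \<le> (SUP \<nu>'. expected_score n \<rho>' \<nu>')"
    by (rule cSUP_upper[OF UNIV_I bdd_above_expected_score])
  moreover have "v \<le> (INF \<rho>'\<in>Collect (admissible n). expected_score n \<rho>' \<nu>')"
    using opt(2) inf unfolding optimal_N_def using order_trans by blast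
  moreover have "(INF \<rho>'\<in>Collect (admissible n). expected_score n \<rho>' \<nu>') \<le> expected_score n \<rho>' \<nu>'"
    by (rule cINF_lower[OF bdd_below_expected_score]) (use opt(1) in \<open>simp add: optimal_R_def\<close>)
  ultimately show "expected_score n \<rho>' \<nu>' = v" by linarith
qed

lemma game_solution:
  shows "\<exists>\<rho>. optimal_R n \<rho>" and "\<exists>\<nu>. optimal_N n \<nu>"
    and "optimal_R n \<rho> \<Longrightarrow> optimal_N n \<nu> \<Longrightarrow> expected_score n \<rho> \<nu> = val n n n"
proof -
  obtain \<nu>0 where \<nu>0: "\<And>\<rho>. admissible n \<rho> \<Longrightarrow> val n n n \<le> expected_score n \<rho> \<nu>0"
    using N_strategy_ex by blast
  obtain \<rho>0 where \<rho>0: "admissible n \<rho>0" "\<And>\<nu>. expected_score n \<rho>0 \<nu> \<le> val n n n"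
    using R_strategy_ex by blast
  note saddle = saddle[OF \<rho>0 \<nu>0]
  show "\<exists>\<rho>. optimal_R n \<rho>" "\<exists>\<nu>. optimal_N n \<nu>"
    using saddle(1,2) by blast+
  show "optimal_R n \<rho> \<Longrightarrow> optimal_N n \<nu> \<Longrightarrow> expected_score n \<rho> \<nu> = val n n n"
    using saddle(3) by blast
qed

section \<open>Comparison with an unrestricted uniform walk\<close>

text \<open>The expectation of \<open>F\<close> at the end of \<open>k\<close> steps of the walk that starts at \<open>(a, b, c)\<close> and in each
  step lowers one uniformly chosen coordinate by 1. Unlike the stock of cards, this walk does not
  stop when a coordinate reaches 0, and its coordinates may become negative.\<close>
primrec walk_avg :: "nat \<Rightarrow> (real \<Rightarrow> real \<Rightarrow> real \<Rightarrow> real) \<Rightarrow> real \<Rightarrow> real \<Rightarrow> real \<Rightarrow> real" where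
  "walk_avg 0 F a b c = F a b c"
| "walk_avg (Suc k) F a b c =
     (walk_avg k F (a - 1) b c + walk_avg k F a (b - 1) c + walk_avg k F a b (c - 1)) / 3"

lemma walk_avg_add:
  "walk_avg k (\<lambda>a b c. F a b c + G a b c) a b c = walk_avg k F a b c + walk_avg k G a b c"
  by (induction k arbitrary: a b c) (simp_all add: field_simps)

lemma walk_avg_divide:
  "walk_avg k (\<lambda>a b c. F a b c / m) a b c = walk_avg k F a b c / m"
  by (induction k arbitrary: a b c) (simp_all add: field_simps flip: add_divide_distrib)

lemma walk_avg_rotate: "walk_avg k (\<lambda>a b c. F b c a) a b c = walk_avg k F b c a"
  by (induction k arbitrary: a b c) (simp_all add: add_ac)

lemma walk_avg_flip: "walk_avg k (\<lambda>a b c. F c b a) a b c = walk_avg k F c b a"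
  by (induction k arbitrary: a b c) (simp_all add: add_ac)

text \<open>The score that is still to come when one of the moves has just been used up, by the law of large
  numbers: if only \<open>a\<close> rocks and \<open>b\<close> papers are left, \<open>a / b\<close> decides which of the two runs out
  first, and the score is close to \<open>a\<close> or to \<open>b - a\<close> accordingly. The symmetric form extends this
  to all states.\<close>
definition gap :: "real \<Rightarrow> real \<Rightarrow> real \<Rightarrow> real" where
  "gap a b c = max (a - c) (max (b - a) (c - b))"

definition spread :: "real \<Rightarrow> real \<Rightarrow> real \<Rightarrow> real" where
  "spread a b c = (a - b)^2 + (b - c)^2 + (c - a)^2"

lemma gap_rotate: "gap a b c = gap b c a"
  by (simp add: gap_def max.commute max.left_commute)

lemma gap_ge: "a - c \<le> gap a b c" "b - a \<le> gap a b c" "c - b \<le> gap a b c"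
  by (simp_all add: gap_def)

lemma gap_le_iff: "gap a b c \<le> t \<longleftrightarrow> a - c \<le> t \<and> b - a \<le> t \<and> c - b \<le> t"
  by (simp add: gap_def)

lemma avg_mono:
  assumes "x \<le> x'" "y \<le> y'" "z \<le> (z' :: real)"
  shows "(x + y + z) / 3 \<le> (x' + y' + z') / 3"
  using assms by simp

text \<open>Each of the three linear forms under the maximum is preserved by a mean step.\<close>
lemma gap_le_step: "gap a b c \<le> (gap (a - 1) b c + gap a (b - 1) c + gap a b (c - 1)) / 3"
  unfolding gap_le_iff
  using gap_ge[where a = "a - 1" and b = b and c = c] gap_ge[where a = a and b = "b - 1" and c = c]
    gap_ge[where a = a and b = b and c = "c - 1"]
  by auto

lemma gap_le_walk_avg: "gap a b c \<le> walk_avg k gap a b c"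
proof (induction k arbitrary: a b c)
  case (Suc k)
  have "gap a b c \<le> (gap (a - 1) b c + gap a (b - 1) c + gap a b (c - 1)) / 3"
    by (rule gap_le_step)
  also have "\<dots> \<le> walk_avg (Suc k) gap a b c"
    using Suc[of "a - 1" b c] Suc[of a "b - 1" c] Suc[of a b "c - 1"] by simp
  finally show ?case .
qed simp

text \<open>A linear bound by a square, used in place of square roots of expectations: the squares have
  explicit means along the walks, and the free parameter \<open>l\<close> is chosen at the very end.\<close>
lemma young:
  assumes "l > (0::real)"
  shows "t \<le> l + t^2 / (4 * l)"
proof -
  have "0 \<le> (t - 2 * l)^2 / (4 * l)" using assms by simp
  also have "\<dots> = l + t^2 / (4 * l) - t" using assms by (simp add: field_simps power2_eq_square)
  finally show ?thesis by simp
qed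

lemma gap_le_spread:
  assumes l: "l > 0"
  shows "gap a b c \<le> gap a0 b0 c0 + l + spread (a - a0) (b - b0) (c - c0) / (4 * l)"
proof -
  have *: "x \<le> gap a0 b0 c0 + l + spread (a - a0) (b - b0) (c - c0) / (4 * l)"
    if "x0 \<le> gap a0 b0 c0" "(x - x0)^2 \<le> spread (a - a0) (b - b0) (c - c0)" for x x0
  proof -
    have "x - x0 \<le> l + (x - x0)^2 / (4 * l)" by (rule young[OF l])
    also have "\<dots> \<le> l + spread (a - a0) (b - b0) (c - c0) / (4 * l)"
      using that l by (intro add_left_mono divide_right_mono) auto
    finally show ?thesis using that by simp
  qed
  have "((a - c) - (a0 - c0))^2 \<le> spread (a - a0) (b - b0) (c - c0)"
    "((b - a) - (b0 - a0))^2 \<le> spread (a - a0) (b - b0) (c - c0)"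
    "((c - b) - (c0 - b0))^2 \<le> spread (a - a0) (b - b0) (c - c0)"
  proof -
    have "((a - c) - (a0 - c0))^2 = ((c - c0) - (a - a0))^2"
      "((b - a) - (b0 - a0))^2 = ((a - a0) - (b - b0))^2"
      "((c - b) - (c0 - b0))^2 = ((b - b0) - (c - c0))^2"
      by (simp_all add: power2_eq_square algebra_simps)
    then show "((a - c) - (a0 - c0))^2 \<le> spread (a - a0) (b - b0) (c - c0)"
      "((b - a) - (b0 - a0))^2 \<le> spread (a - a0) (b - b0) (c - c0)"
      "((c - b) - (c0 - b0))^2 \<le> spread (a - a0) (b - b0) (c - c0)"
      by (simp_all add: spread_def)
  qed
  then show ?thesis
    unfolding gap_le_iff using *[OF gap_ge(1)] *[OF gap_ge(2)] *[OF gap_ge(3)] by blast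
qed

lemma spread_step:
  "spread (a - 1) b c + spread a (b - 1) c + spread a b (c - 1) = 3 * (spread a b c + 2)"
  by (simp add: spread_def power2_eq_square algebra_simps)

text \<open>A step raises the mean of \<^const>\<open>spread\<close> by 2. The reference point \<open>(a0, b0, c0)\<close> has to stay
  fixed while the walk moves; only afterwards is it taken to be the starting point.\<close>
lemma walk_avg_gap_le_spread:
  assumes l: "l > 0"
  shows "walk_avg k gap a b c
    \<le> gap a0 b0 c0 + l + (spread (a - a0) (b - b0) (c - c0) + 2 * real k) / (4 * l)"
proof (induction k arbitrary: a b c)
  case 0
  then show ?case using gap_le_spread[OF l] by simp
next
  case (Suc k)
  let ?S = "\<lambda>a b c. gap a0 b0 c0 + l + (spread (a - a0) (b - b0) (c - c0) + 2 * real k) / (4 * l)"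
  have "walk_avg (Suc k) gap a b c \<le> (?S (a - 1) b c + ?S a (b - 1) c + ?S a b (c - 1)) / 3"
    unfolding walk_avg.simps by (intro avg_mono Suc)
  also have "\<dots> = gap a0 b0 c0 + l +
     ((spread (a - a0 - 1) (b - b0) (c - c0) + spread (a - a0) (b - b0 - 1) (c - c0)
        + spread (a - a0) (b - b0) (c - c0 - 1)) / 3 + 2 * real k) / (4 * l)"
    using l by (simp add: field_simps diff_right_commute)
  also have "\<dots> = gap a0 b0 c0 + l + (spread (a - a0) (b - b0) (c - c0) + 2 * real (Suc k)) / (4 * l)"
    by (simp add: spread_step)
  finally show ?case .
qed

lemma walk_avg_gap_le:
  assumes l: "l > 0"
  shows "walk_avg k gap a b c \<le> gap a b c + l + real k / (2 * l)"
  using walk_avg_gap_le_spread[OF l, of k a b c a b c] l by (simp add: spread_def field_simps)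

lemma two_val_ge: "max (real x) (real y - real x) \<le> two_val x y"
  by (induction x y rule: two_val.induct) auto

text \<open>In a round with the probabilities 1/3 and 2/3 the mean loss in \<open>x\<close> equals the gain 1/3 of the
  round, whereas \<open>y - 2 * x\<close> and \<open>(y - 2 * x)\<^sup>2 + 2 * (x + y)\<close> do not change in the mean. On the axes the excess
  of the value over \<open>x\<close> is the positive part of \<open>y - 2 * x\<close>, which is compared with that of a fixed
  reference point \<open>z\<close>.\<close>
lemma two_val_le_square:
  assumes l: "l > 0"
  shows "two_val x y \<le> real x + max 0 z + l + ((real y - 2 * real x - z)^2 + 2 * (real x + real y)) / (4 * l)"
proof (induction x y rule: two_val.induct)
  case (1 y)
  have "real y - z \<le> l + (real y - z)^2 / (4 * l)" by (rule young[OF l])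
  also have "\<dots> \<le> l + ((real y - z)^2 + 2 * real y) / (4 * l)"
    using l by (intro add_left_mono divide_right_mono) auto
  finally show ?case by simp
next
  case (2 x)
  then show ?case using l by simp
next
  case (3 x y)
  let ?B = "\<lambda>x y. x + max 0 z + l + ((y - 2 * x - z)^2 + 2 * (x + y)) / (4 * l)"
  have "two_val (Suc x) (Suc y) \<le> 1/3 + ?B (real x) (real (Suc y)) / 3 + 2/3 * ?B (real (Suc x)) (real y)"
    unfolding two_val.simps
    by (intro add_mono mult_left_mono divide_right_mono 3 order_refl) auto
  also have "\<dots> = ?B (real (Suc x)) (real (Suc y))"
    using l by (simp add: field_simps power2_eq_square)
  finally show ?case by simp
qed

lemma two_val_le:
  assumes l: "l > 0"
  shows "two_val x y \<le> max (real x) (real y - real x) + l + (real x + real y) / (2 * l)"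
proof -
  have "real x + max 0 (real y - 2 * real x) = max (real x) (real y - real x)" by (simp add: max_def)
  then show ?thesis
    using two_val_le_square[OF l, of x y "real y - 2 * real x"] l
    by (simp add: field_simps)
qed

lemma two_val_near_gap:
  assumes l: "l > 0"
  shows "gap x y 0 \<le> two_val x y" "two_val x y \<le> gap x y 0 + l + (real x + real y) / (2 * l)"
proof -
  have "gap x y 0 = max (real x) (real y - real x)" by (auto simp: gap_def)
  then show "gap x y 0 \<le> two_val x y" "two_val x y \<le> gap x y 0 + l + (real x + real y) / (2 * l)"
    using two_val_ge[of x y] two_val_le[OF l, of x y] by simp_all
qed

lemma val_near_gap_boundary:
  assumes l: "l > 0" and zero: "a = 0 \<or> b = 0 \<or> c = 0"
  shows "gap a b c \<le> val a b c" "val a b c \<le> gap a b c + l + (real a + real b + real c) / (2 * l)"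
proof -
  have "gap a b c \<le> val a b c \<and> val a b c \<le> gap a b c + l + (real a + real b + real c) / (2 * l)"
    using zero
  proof (elim disjE)
    assume "a = 0"
    then show ?thesis using two_val_near_gap[OF l, of b c] gap_rotate[of a b c] by simp
  next
    assume "b = 0"
    then show ?thesis using two_val_near_gap[OF l, of c a] gap_rotate[of c a b] by (simp add: add_ac)
  next
    assume "c = 0"
    then show ?thesis using two_val_near_gap[OF l, of a b] by simp
  qed
  then show "gap a b c \<le> val a b c" "val a b c \<le> gap a b c + l + (real a + real b + real c) / (2 * l)"
    by simp_all
qed

text \<open>When a move is used up, the number of remaining rounds is itself a fluctuation: it is controlled
  by the differences of the stocks.\<close>
lemma total_sq_le_spread:
  assumes "a = 0 \<or> b = 0 \<or> c = (0::real)"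
  shows "(a + b + c)^2 \<le> 2 * spread a b c"
proof -
  have *: "(x + y)^2 \<le> 2 * ((x - y)^2 + y^2 + x^2)" for x y :: real
  proof -
    have "2 * ((x - y)^2 + y^2 + x^2) - (x + y)^2 = 3 * (x - y)^2"
      by (simp add: power2_eq_square algebra_simps)
    then show ?thesis by (smt (verit) zero_le_power2)
  qed
  show ?thesis using assms *[of a b] *[of b c] *[of c a]
    by (elim disjE) (simp_all add: spread_def add_ac power2_commute)
qed

text \<open>The error bound. A uniform step raises the mean of \<^const>\<open>spread\<close> by 2 and lowers \<open>a + b + c\<close> by
  1, so \<open>err\<close> is harmonic for the walk. The parameter \<open>K\<close> stands for the typical number of rounds left
  when a move is used up, and \<open>l\<close> for the fluctuations within these rounds.\<close>
definition err :: "real \<Rightarrow> real \<Rightarrow> real \<Rightarrow> real \<Rightarrow> real \<Rightarrow> real" where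
  "err l K a b c = l + K / (2 * l) + (spread a b c + 2 * (a + b + c)) / (4 * K * l)"

lemma err_step: "(err l K (a - 1) b c + err l K a (b - 1) c + err l K a b (c - 1)) / 3 = err l K a b c"
proof -
  have combine: "((p + u) + (p + v) + (p + w)) / 3 = p + t" if "u + v + w = 3 * t" for p u v w t :: real
    using that by (simp add: field_simps)
  show ?thesis
    unfolding err_def
  proof (rule combine)
    let ?n = "\<lambda>a b c. spread a b c + 2 * (a + b + c)"
    have "?n (a - 1) b c + ?n a (b - 1) c + ?n a b (c - 1) = 3 * ?n a b c"
      using spread_step[of a b c] by simp
    then show "?n (a - 1) b c / (4 * K * l) + ?n a (b - 1) c / (4 * K * l) + ?n a b (c - 1) / (4 * K * l)
        = 3 * (?n a b c / (4 * K * l))"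
      by (metis add_divide_distrib times_divide_eq_right)
  qed
qed

lemma boundary_le_err:
  assumes l: "l > 0" and K: "K > 0" and zero: "a = 0 \<or> b = 0 \<or> c = 0"
    and nonneg: "a \<ge> 0" "b \<ge> 0" "c \<ge> 0"
  shows "l + (a + b + c) / (2 * l) \<le> err l K a b c"
proof -
  have "a + b + c \<le> K + (a + b + c)^2 / (4 * K)" by (rule young[OF K])
  also have "\<dots> \<le> K + (2 * spread a b c) / (4 * K)"
    using total_sq_le_spread[OF zero] K by (intro add_left_mono divide_right_mono) auto
  finally have "(a + b + c) / (2 * l) \<le> (K + (2 * spread a b c) / (4 * K)) / (2 * l)"
    using l by (intro divide_right_mono) auto
  also have "\<dots> = K / (2 * l) + spread a b c / (4 * K * l)"
    using l K by (simp add: field_simps)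
  also have "\<dots> \<le> K / (2 * l) + (spread a b c + 2 * (a + b + c)) / (4 * K * l)"
    using l K nonneg by (intro add_left_mono divide_right_mono) auto
  finally show ?thesis by (simp add: err_def)
qed

lemma val_near_walk_avg_boundary:
  fixes a b c :: nat
  assumes l: "l > 0" and K: "K > 0" and zero: "a = 0 \<or> b = 0 \<or> c = 0"
  shows "\<bar>val a b c - walk_avg (a + b + c) gap a b c\<bar> \<le> err l K a b c"
proof -
  have "walk_avg (a + b + c) gap a b c \<le> gap a b c + l + (real a + real b + real c) / (2 * l)"
    using walk_avg_gap_le[OF l, of "a + b + c" a b c] by simp
  moreover have "l + (real a + real b + real c) / (2 * l) \<le> err l K a b c"
    using zero by (intro boundary_le_err[OF l K]) auto
  ultimately show ?thesis
    using val_near_gap_boundary[OF l zero] gap_le_walk_avg[of a b c "a + b + c"]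
    unfolding abs_le_iff by linarith
qed

lemma abs_avg:
  assumes "\<bar>x\<bar> \<le> x'" "\<bar>y\<bar> \<le> y'" "\<bar>z\<bar> \<le> (z' :: real)"
  shows "\<bar>(x + y + z) / 3\<bar> \<le> (x' + y' + z') / 3"
  using assms by (simp add: abs_le_iff)

text \<open>In the interior both quantities satisfy the same recursion, so their difference is an average of
  differences on the boundary. There both lie above \<^const>\<open>gap\<close> by at most
  \<open>l + (a + b + c) / (2 * l)\<close>.\<close>
lemma val_near_walk_avg:
  assumes l: "l > 0" and K: "K > 0"
  shows "\<bar>val a b c - walk_avg (a + b + c) gap a b c\<bar> \<le> err l K a b c"
proof (induction a b c rule: val.induct)
  case (1 a b c)
  let ?d = "\<lambda>a b c. val a b c - walk_avg (a + b + c) gap (real a) (real b) (real c)"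
  have "?d (Suc a) (Suc b) (Suc c)
      = (?d a (Suc b) (Suc c) + ?d (Suc a) b (Suc c) + ?d (Suc a) (Suc b) c) / 3"
    by (simp add: add_divide_distrib diff_divide_distrib)
  then have "\<bar>?d (Suc a) (Suc b) (Suc c)\<bar>
      \<le> (err l K a (Suc b) (Suc c) + err l K (Suc a) b (Suc c) + err l K (Suc a) (Suc b) c) / 3"
    using 1 by (simp only: abs_avg)
  also have "\<dots> = err l K (Suc a) (Suc b) (Suc c)"
    using err_step[of l K "Suc a" "Suc b" "Suc c"] by simp
  finally show ?case .
next
  case (2 a b)
  show ?case by (rule val_near_walk_avg_boundary[OF l K]) simp
next
  case (3 b c)
  show ?case by (rule val_near_walk_avg_boundary[OF l K]) simp
next
  case (4 a c)
  show ?case by (rule val_near_walk_avg_boundary[OF l K]) simp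
qed

section \<open>The mean gap of the unrestricted walk\<close>

text \<open>The binomial distribution with parameters \<open>k\<close> and \<open>1/3\<close>.\<close>
definition binom_third :: "nat \<Rightarrow> nat \<Rightarrow> real" where
  "binom_third k j = real (k choose j) * 2 ^ (k - j) / 3 ^ k"

lemma binom_third_beyond [simp]: "k < j \<Longrightarrow> binom_third k j = 0"
  by (simp add: binom_third_def)

lemma binom_third_Suc_0: "binom_third (Suc k) 0 = 2/3 * binom_third k 0"
  by (simp add: binom_third_def)

lemma binom_third_Suc_Suc:
  "binom_third (Suc k) (Suc j) = binom_third k j / 3 + 2/3 * binom_third k (Suc j)"
proof (cases "j < k")
  case True
  then have "k - j = Suc (k - Suc j)" by simp
  then have "(2::real) ^ (k - j) = 2 * 2 ^ (k - Suc j)" by simp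
  then show ?thesis by (simp add: binom_third_def field_simps)
next
  case False
  then show ?thesis by (simp add: binom_third_def binomial_eq_0)
qed

text \<open>A step lowers \<open>2 * a - b - c\<close> by 2 with probability 1/3 and raises it by 1 otherwise.\<close>
lemma walk_avg_one_coord:
  "walk_avg k (\<lambda>a b c. \<phi> (2 * a - b - c)) a b c
     = (\<Sum>j\<le>k. binom_third k j * \<phi> (2 * a - b - c + real k - 3 * real j))"
proof (induction k arbitrary: a b c)
  case 0
  then show ?case by (simp add: binom_third_def)
next
  case (Suc k)
  define f where "f j = \<phi> (2 * a - b - c + real (Suc k) - 3 * real j)" for j
  have down: "walk_avg k (\<lambda>a b c. \<phi> (2 * a - b - c)) (a - 1) b c = (\<Sum>j\<le>k. binom_third k j * f (Suc j))"
    unfolding Suc f_def by (intro sum.cong refl arg_cong2[where f = "(*)"] arg_cong[where f = \<phi>]) auto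
  have up: "walk_avg k (\<lambda>a b c. \<phi> (2 * a - b - c)) a (b - 1) c = (\<Sum>j\<le>k. binom_third k j * f j)"
     "walk_avg k (\<lambda>a b c. \<phi> (2 * a - b - c)) a b (c - 1) = (\<Sum>j\<le>k. binom_third k j * f j)"
    unfolding Suc f_def by (intro sum.cong refl arg_cong2[where f = "(*)"] arg_cong[where f = \<phi>]; simp)+
  \<comment> \<open>The added term is 0; it aligns the sum with the shifted one.\<close>
  have "(\<Sum>j\<le>k. binom_third k j * f j) = (\<Sum>j\<le>Suc k. binom_third k j * f j)" by simp
  also have "\<dots> = binom_third k 0 * f 0 + (\<Sum>j\<le>k. binom_third k (Suc j) * f (Suc j))"
    by (rule sum.atMost_Suc_shift)
  finally have shift: "(\<Sum>j\<le>k. binom_third k j * f j)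
     = binom_third k 0 * f 0 + (\<Sum>j\<le>k. binom_third k (Suc j) * f (Suc j))" .
  have "(\<Sum>j\<le>Suc k. binom_third (Suc k) j * f j)
      = 2/3 * binom_third k 0 * f 0 + (\<Sum>j\<le>k. (binom_third k j / 3 + 2/3 * binom_third k (Suc j)) * f (Suc j))"
    unfolding sum.atMost_Suc_shift binom_third_Suc_0 binom_third_Suc_Suc ..
  also have "\<dots> = ((\<Sum>j\<le>k. binom_third k j * f (Suc j)) + 2 * (\<Sum>j\<le>k. binom_third k j * f j)) / 3"
    unfolding shift
    by (simp add: distrib_right sum.distrib sum_distrib_left sum_divide_distrib add_divide_distrib mult.assoc)
  finally show ?case by (simp add: down up f_def)
qed

lemma binom_third_ratio:
  "2 * (real (Suc j) * binom_third k (Suc j)) = (real k - real j) * binom_third k j"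
proof (cases "j < k")
  case True
  then have "k - j = Suc (k - Suc j)" by simp
  then have p: "(2::real) ^ (k - j) = 2 * 2 ^ (k - Suc j)" by simp
  have "Suc j * (k choose Suc j) = (k - j) * (k choose j)"
    using binomial_absorb_comp[of k j] binomial_absorption[of j "k"] by simp
  then have h: "real (Suc j) * real (k choose Suc j) = (real k - real j) * real (k choose j)"
    using True by (metis of_nat_diff of_nat_mult less_imp_le)
  have "2 * (real (Suc j) * binom_third k (Suc j))
      = 2 * (real (Suc j) * real (k choose Suc j)) * 2 ^ (k - Suc j) / 3 ^ k"
    by (simp only: binom_third_def times_divide_eq_right mult.assoc)
  also have "\<dots> = (real k - real j) * binom_third k j"
    unfolding h binom_third_def p by simp
  finally show ?thesis .
next
  case False
  then show ?thesis by (cases "j = k") auto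
qed

text \<open>De Moivre's formula for the mean absolute deviation. By \<open>binom_third_ratio\<close> the terms without
  absolute value are differences of a sequence \<open>T\<close> that vanishes at both ends; both the part below
  and the part above the mean therefore contribute the value of \<open>T\<close> at the mean.\<close>
lemma mean_abs_deviation:
  "(\<Sum>j\<le>3 * n. binom_third (3 * n) j * \<bar>3 * real n - 3 * real j\<bar>) = 4 * real n * binom_third (3 * n) n"
proof -
  let ?b = "binom_third (3 * n)"
  define T where "T j = 2 * (real j * ?b j)" for j
  have diff: "T (Suc j) - T j = ?b j * (3 * real n - 3 * real j)" for j
    using binom_third_ratio[of j "3 * n"] by (simp add: T_def algebra_simps)
  have "{..3 * n} = {..<n} \<union> {n..<Suc (3 * n)}" by auto
  then have "(\<Sum>j\<le>3 * n. ?b j * \<bar>3 * real n - 3 * real j\<bar>)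
     = (\<Sum>j<n. ?b j * \<bar>3 * real n - 3 * real j\<bar>) + (\<Sum>j=n..<Suc (3 * n). ?b j * \<bar>3 * real n - 3 * real j\<bar>)"
    by (simp only:) (rule sum.union_disjoint, auto)
  also have "(\<Sum>j<n. ?b j * \<bar>3 * real n - 3 * real j\<bar>) = (\<Sum>j<n. T (Suc j) - T j)"
    by (intro sum.cong) (auto simp: diff)
  also have "\<dots> = T n" by (subst sum_lessThan_telescope) (simp add: T_def)
  also have "(\<Sum>j=n..<Suc (3 * n). ?b j * \<bar>3 * real n - 3 * real j\<bar>) = (\<Sum>j=n..<Suc (3 * n). - (T (Suc j) - T j))"
    by (intro sum.cong) (auto simp: diff algebra_simps)
  also have "\<dots> = T n"
    unfolding sum_negf by (subst sum_Suc_diff') (simp_all add: T_def)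
  finally show ?thesis by (simp add: T_def)
qed

text \<open>Exchanging the outer coordinates turns the maximum of the three cyclic differences into minus
  their minimum, and the range of three numbers is half the sum of their mutual distances. Their
  maximum becomes accessible in this way to a one-dimensional computation.\<close>
lemma gap_add_flip:
  "gap a b c + gap c b a = (\<bar>2 * a - b - c\<bar> + \<bar>2 * b - c - a\<bar> + \<bar>2 * c - a - b\<bar>) / 2"
  by (auto simp: gap_def max_def abs_if)

text \<open>The diagonal starting point is invariant under all permutations of the coordinates, so the flipped
  gap has the same mean, and so have the three absolute values. After \<open>3 * n\<close> steps the
  coordinates add up to 0, whence the absolute value measures the deviation of a single binomial
  count.\<close>
lemma walk_avg_gap_diagonal: "walk_avg (3 * n) gap n n n = 3 * real n * binom_third (3 * n) n"
proof -
  let ?w = "\<lambda>F. walk_avg (3 * n) F (real n) (real n) (real n)"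
  let ?A = "\<lambda>a b c. \<bar>2 * a - b - c\<bar> :: real"
  have A: "?w ?A = 4 * real n * binom_third (3 * n) n"
    using walk_avg_one_coord[of "3 * n" abs n n n] mean_abs_deviation[of n] by simp
  have "2 * ?w gap = ?w gap + ?w (\<lambda>a b c. gap c b a)"
    by (simp only: walk_avg_flip[of "3 * n" gap] mult_2)
  also have "\<dots> = ?w (\<lambda>a b c. (?A a b c + ?A b c a + ?A c a b) / 2)"
    unfolding walk_avg_add[symmetric] gap_add_flip ..
  also have "\<dots> = (?w ?A + ?w (\<lambda>a b c. ?A b c a) + ?w (\<lambda>a b c. ?A c a b)) / 2"
    unfolding walk_avg_divide walk_avg_add ..
  also have "\<dots> = 3/2 * ?w ?A"
    using walk_avg_rotate[of "3 * n" ?A n n n]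
      walk_avg_rotate[of "3 * n" "\<lambda>a b c. ?A b c a" n n n] by simp
  finally show ?thesis using A by simp
qed

lemma fact_triple: "(fact (3 * n) :: real) = 27 ^ n * fact n * pochhammer (1/3) n * pochhammer (2/3) n"
proof (induction n)
  case (Suc n)
  have "(fact (3 * Suc n) :: real)
      = (3 * real n + 3) * (3 * real n + 2) * (3 * real n + 1) * fact (3 * n)"
    by (simp add: numeral_3_eq_3 algebra_simps)
  also have "\<dots> = 27 ^ Suc n * fact (Suc n) * pochhammer (1/3) (Suc n) * pochhammer (2/3) (Suc n)"
    unfolding Suc pochhammer_Suc by (simp add: field_simps)
  finally show ?case .
qed simp

text \<open>Splitting the factorials by residues modulo 3 and 2 writes the central weight as a quotient of
  rising factorials. Their growth is known from Euler's limit for \<open>Gamma\<close>, which yields the constant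
  with the reflection formula.\<close>
lemma binom_third_pochhammer:
  "binom_third (3 * n) n = pochhammer (1/3) n * pochhammer (2/3) n / (fact n * pochhammer (1/2) n)"
proof -
  have p: "(2::real) ^ (2 * n) = 4 ^ n" "(3::real) ^ (3 * n) = 27 ^ n"
    by (simp_all add: power_mult)
  have "binom_third (3 * n) n = fact (3 * n) / (fact n * fact (2 * n)) * 2 ^ (2 * n) / 3 ^ (3 * n)"
    by (simp add: binom_third_def binomial_fact)
  also have "\<dots> = pochhammer (1/3) n * pochhammer (2/3) n / (fact n * pochhammer (1/2) n)"
    unfolding fact_triple fact_double p by (simp add: field_simps)
  finally show ?thesis .
qed

lemma Gamma_third_prod: "Gamma (1/3) * Gamma (2/3 :: real) = 2 * pi / sqrt 3"
proof -
  have "complex_of_real (Gamma (1/3) * Gamma (2/3)) = Gamma (complex_of_real (1/3)) * Gamma (1 - complex_of_real (1/3))"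
    by (simp flip: Gamma_complex_of_real)
  also have "\<dots> = of_real pi / sin (of_real pi * complex_of_real (1/3))"
    by (rule Gamma_reflection_complex)
  also have "\<dots> = complex_of_real (pi / sin (pi / 3))"
    by (simp flip: sin_of_real)
  finally have "Gamma (1/3) * Gamma (2/3 :: real) = pi / sin (pi / 3)"
    by (simp only: of_real_eq_iff)
  then show ?thesis by (simp add: sin_60)
qed

lemma binom_third_asymp:
  "(\<lambda>n. sqrt (real n) * binom_third (3 * n) n) \<longlonglongrightarrow> sqrt 3 / (2 * sqrt pi)"
proof -
  let ?G = "\<lambda>z::real. Gamma_series' z"
  have pos: "Gamma (1/3) * Gamma (2/3 :: real) \<noteq> 0"
    by (simp add: Gamma_third_prod)
  have "(\<lambda>n. ?G (1/2) n / (?G (1/3) n * ?G (2/3) n)) \<longlonglongrightarrow> Gamma (1/2) / (Gamma (1/3) * Gamma (2/3))"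
    by (intro tendsto_intros Gamma_series'_LIMSEQ pos)
  moreover have "Gamma (1/2) / (Gamma (1/3) * Gamma (2/3 :: real)) = sqrt 3 / (2 * sqrt pi)"
    by (simp add: Gamma_third_prod Gamma_one_half_real field_simps)
  moreover have "eventually (\<lambda>n. ?G (1/2) n / (?G (1/3) n * ?G (2/3) n)
      = sqrt (real n) * binom_third (3 * n) n) sequentially"
    using eventually_gt_at_top[of 0]
  proof eventually_elim
    case (elim n)
    have e: "exp (1/2 * ln (real n)) = sqrt (real n)"
      using elim by (simp add: powr_half_sqrt[symmetric] powr_def)
    have "exp (1/3 * ln (real n)) * exp (2/3 * ln (real n)) = exp (ln (real n))"
      unfolding exp_add[symmetric] by simp
    then have e': "exp (1/3 * ln (real n)) * exp (2/3 * ln (real n)) = real n"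
      using elim by simp
    have f: "fact n = real n * fact (n - 1)" using elim by (simp add: fact_reduce)
    have nz: "pochhammer (1/3) n \<noteq> (0::real)" "pochhammer (2/3) n \<noteq> (0::real)" "pochhammer (1/2) n \<noteq> (0::real)"
      by (auto simp: pochhammer_eq_0_iff add_nonneg_eq_0_iff)
    have "?G (1/2) n / (?G (1/3) n * ?G (2/3) n)
        = sqrt (real n) * (pochhammer (1/3) n * pochhammer (2/3) n)
            / ((exp (1/3 * ln (real n)) * exp (2/3 * ln (real n))) * fact (n - 1) * pochhammer (1/2) n)"
      unfolding Gamma_series'_def e[symmetric] by (simp add: field_simps)
    then show ?case unfolding e' f binom_third_pochhammer by (simp add: mult_ac)
  qed
  ultimately show ?thesis using Lim_transform_eventually by fastforce
qed

text \<open>The choice \<open>l = n powr (1/4)\<close>, \<open>K = sqrt n\<close> balances the terms of \<^const>\<open>err\<close> at \<open>(n, n, n)\<close>,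
  and the error is \<open>3 * n powr (1/4)\<close>.\<close>
lemma val_diagonal_asymp: "(\<lambda>n. val n n n / sqrt (real n)) \<longlonglongrightarrow> 3 * sqrt 3 / (2 * sqrt pi)"
proof -
  define \<delta> where "\<delta> n = (val n n n - 3 * real n * binom_third (3 * n) n) / sqrt (real n)" for n
  have "\<delta> \<longlonglongrightarrow> 0"
  proof (rule Lim_null_comparison)
    show "eventually (\<lambda>n. norm (\<delta> n) \<le> 3 * real n powr (- 1/4)) sequentially"
      using eventually_gt_at_top[of 0]
    proof eventually_elim
      case (elim n)
      define l where "l = real n powr (1/4)"
      have l: "l > 0" using elim by (simp add: l_def)
      have l2: "sqrt (real n) = l^2" and l4: "real n = l^4"
        using elim by (simp_all add: l_def powr_half_sqrt[symmetric] powr_powr flip: powr_numeral)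
      have "\<bar>val n n n - walk_avg (n + n + n) gap n n n\<bar> \<le> err l (l^2) n n n"
        using l by (intro val_near_walk_avg) auto
      also have "n + n + n = 3 * n" by simp
      also have "err l (l^2) n n n = 3 * l"
        using l unfolding err_def spread_def l4 by (simp add: field_simps power_numeral_reduce)
      finally have "norm (\<delta> n) \<le> 3 * l / sqrt (real n)"
        unfolding walk_avg_gap_diagonal \<delta>_def by (simp add: divide_right_mono)
      also have "\<dots> = 3 * inverse l" unfolding l2 using l by (simp add: field_simps power2_eq_square)
      also have "inverse l = real n powr (- 1/4)" by (simp add: l_def powr_minus)
      finally show ?case .
    qed
    show "(\<lambda>n. 3 * real n powr (- 1/4)) \<longlonglongrightarrow> 0"
      by (rule tendsto_eq_intros tendsto_neg_powr filterlim_real_sequentially | simp)+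
  qed
  then have "(\<lambda>n. 3 * (sqrt (real n) * binom_third (3 * n) n) + \<delta> n) \<longlonglongrightarrow> 3 * (sqrt 3 / (2 * sqrt pi)) + 0"
    by (intro tendsto_intros binom_third_asymp)
  moreover have "3 * (sqrt (real n) * binom_third (3 * n) n) + \<delta> n = val n n n / sqrt (real n)" for n
  proof (cases "n = 0")
    case False
    have "3 * real n * binom_third (3 * n) n / sqrt (real n) = 3 * (sqrt (real n) * binom_third (3 * n) n)"
      using real_div_sqrt[of "real n"] by (metis (no_types, lifting) mult.assoc mult.commute of_nat_0_le_iff times_divide_eq_left)
    then show ?thesis by (simp add: \<delta>_def diff_divide_distrib)
  qed (simp add: \<delta>_def)
  ultimately show ?thesis by simp
qed

section \<open>The asymptotic value\<close>

lemma sqrt_constant: "sqrt (27 * real n / (4 * pi)) = 3 * sqrt 3 / (2 * sqrt pi) * sqrt (real n)"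
proof -
  have "sqrt 27 = 3 * sqrt (3::real)" using real_sqrt_mult[of 9 3] by simp
  then show ?thesis by (simp add: real_sqrt_divide real_sqrt_mult)
qed

theorem theorem1p1:
  "(\<forall>n\<ge>1. (\<exists>\<rho>. optimal_R n \<rho>) \<and> (\<exists>\<nu>. optimal_N n \<nu>)) \<and>
   (\<forall>(\<rho> :: nat \<Rightarrow> strategy) (\<nu> :: nat \<Rightarrow> strategy).
      (\<forall>n\<ge>1. optimal_R n (\<rho> n) \<and> optimal_N n (\<nu> n)) \<longrightarrow>
      (\<lambda>n. expected_score n (\<rho> n) (\<nu> n)) \<sim>[at_top] (\<lambda>n. sqrt (27 * real n / (4 * pi)))) \<and>
   (\<forall>n::nat. sqrt (27 * real n / (4 * pi)) = 3 * sqrt 3 / (2 * sqrt pi) * sqrt (real n))"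
proof (intro conjI allI impI)
  fix n :: nat
  show "\<exists>\<rho>. optimal_R n \<rho>" and "\<exists>\<nu>. optimal_N n \<nu>" by (rule game_solution)+
  show "sqrt (27 * real n / (4 * pi)) = 3 * sqrt 3 / (2 * sqrt pi) * sqrt (real n)"
    by (rule sqrt_constant)
next
  fix \<rho> \<nu> :: "nat \<Rightarrow> strategy"
  assume opt: "\<forall>n\<ge>1. optimal_R n (\<rho> n) \<and> optimal_N n (\<nu> n)"
  let ?C = "3 * sqrt 3 / (2 * sqrt pi)"
  have "(\<lambda>n. val n n n / sqrt (real n) / ?C) \<longlonglongrightarrow> ?C / ?C"
    by (intro tendsto_divide val_diagonal_asymp tendsto_const) simp
  moreover have "eventually (\<lambda>n. val n n n / sqrt (real n) / ?C
      = expected_score n (\<rho> n) (\<nu> n) / sqrt (27 * real n / (4 * pi))) sequentially"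
    using eventually_ge_at_top[of 1]
  proof eventually_elim
    case (elim n)
    then have "expected_score n (\<rho> n) (\<nu> n) = val n n n"
      using opt game_solution(3) by blast
    then show ?case unfolding sqrt_constant by (simp add: mult_ac)
  qed
  ultimately have "(\<lambda>n. expected_score n (\<rho> n) (\<nu> n) / sqrt (27 * real n / (4 * pi))) \<longlonglongrightarrow> ?C / ?C"
    by (rule Lim_transform_eventually)
  then show "(\<lambda>n. expected_score n (\<rho> n) (\<nu> n)) \<sim>[at_top] (\<lambda>n. sqrt (27 * real n / (4 * pi)))"
    by (intro asymp_equivI') simp
qed

end
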